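(* Let $(M^2,[\nabla])$ be a smooth projective surface with fixed volume form $\epsilon$, let $\nabla\in[\nabla]$ be the connection with $\nabla_a\epsilon_{bc}=0$, and let $\rho$ and the polynomials $P_1(t),P_2(t),P_3(t)$ (whose coefficients are functions on $M$) be as defined in the context. Assume $\rho\neq0$ everywhere on $M$. Suppose $M$ admits a solution $\alpha_a$ of the pEW equation $\nabla_{(a}\alpha_{b)}+\alpha_a\alpha_b+\mathrm{P}_{(ab)}=0$. Then at every point of $M$ the resultants, with respect to the variable $t$, satisfy $$\mathrm{Res}(P_1(t),P_2(t))=\mathrm{Res}(P_2(t),P_3(t))=\mathrm{Res}(P_1(t),P_3(t))=0 .$$
   Context: Abstract index notation is used; round and square brackets on indices denote symmetrization and skew-symmetrization with factor $1/2$. Everything is smooth. A projective structure $[\nabla]$ on a manifold $M$ is an equivalence class of torsion-free affine connections having the same unparametrized geodesics; equivalently, $\hat\nabla$ and $\nabla$ are projectively equivalent iff $\hat\nabla_a\omega_b=\nabla_a\omega_b-\Upsilon_a\omega_b-\Upsilon_b\omega_a$ for some 1-form $\Upsilon_a$. A projective surface is a 2-dimensional manifold with a projective structure. The curvature is $(\nabla_a\nabla_b-\nabla_b\nabla_a)X^c=R_{ab}{}^c{}_dX^d$, the Ricci tensor is $R_{ab}=R_{ca}{}^c{}_b$, and in dimension $n$ the projective rho tensor is $\mathrm{P}_{ab}=\frac{n}{n^2-1}R_{ab}+\frac{1}{n^2-1}R_{ba}$ (here $n=2$). A volume form $\epsilon_{ab}$ on $M$ is fixed, with inverse $\epsilon^{ab}$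 normalized by $\epsilon^{ab}\epsilon_{ab}=2$, $\epsilon^{ac}\epsilon_{bc}=\delta^a{}_b$. The connection $\nabla\in[\nabla]$ is chosen so that $\nabla_a\epsilon_{bc}=0$; then $\mathrm{P}_{ab}$ is symmetric. Indices are raised and lowered by $V^a=\epsilon^{ab}V_b$, $V_b=V^a\epsilon_{ab}$. The Cotton-York tensor is $Y_{abc}=\nabla_a\mathrm{P}_{bc}-\nabla_b\mathrm{P}_{ac}$, and $Y_a:=\epsilon^{bc}Y_{bca}$, so $Y_{abc}=\frac12\epsilon_{ab}Y_c$. Define $$\phi=2\nabla_aY^a,\qquad W^a=Y^b\nabla_bY^a-\frac{2\phi}{3}Y^a,\qquad \rho=Y_aW^a,\qquad \ell=\frac{5\phi^2}{12}+3\mathrm{P}_{ac}Y^aY^c-\frac{Y^a\nabla_a\phi}{2}.$$ The projective Einstein-Weyl (pEW) equation for a 1-form $\alpha_a$ on $M$ is $\nabla_{(a}\alpha_{b)}+\alpha_a\alpha_b+\mathrm{P}_{(ab)}=0$; it expresses that some connection in $[\nabla]$ has skew-symmetric Ricci tensor. When $\rho\ne0$, the polynomials are $$P_1(t)=-90t^6+a_1t^4+a_2t^2-9\rho t+a_3,$$ $$P_2(t)=-275t^8+b_1t^4+20\rho t^3+b_2t^2+b_3,$$ $$P_3(t)=-40t^6+c_1t^4+c_2t^2+\rho t+c_3,$$ where $$a_1=15\left(\frac{Y^a\nabla_a\rho}{\rho}-\frac{5\phi}{2}\right),\qquad a_2=-\left(\frac{3W^a\nabla_a\rho}{\rho}+6\ell-3\nabla_aW^a\right),$$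 $$a_3=\frac{W^a\nabla_a\phi}{2}+\frac{\phi}{2}\nabla_aW^a+Y^a\nabla_a\ell+\frac{\phi\ell}{2}-\frac{\phi W^a\nabla_a\rho}{2\rho}-\ell\,\frac{Y^a\nabla_a\rho}{\rho},$$ $$b_1=-\frac{5W^eY^d\nabla_eW_d}{\rho}+\frac{50\ell}{3},\qquad b_2=\frac{W^eW^a\nabla_eW_a}{\rho},$$ $$b_3=\frac{\phi W^eW^a\nabla_eW_a}{6\rho}+\mathrm{P}_{ea}W^eW^a+\frac{\ell^2}{9}+\frac{\ell W^eY^d\nabla_eW_d}{3\rho}+\frac{W^e\nabla_e\ell}{3},$$ $$c_1=-\frac{5Y^a(W^e\nabla_eY_a+Y^e\nabla_aW_e)}{2\rho}-\frac{25\phi}{6},\qquad c_2=\frac{2\ell}{3}+\frac{W^e(W^d\nabla_eY_d+Y^d\nabla_dW_e)}{2\rho},$$ $$c_3=-\frac{W^e\nabla_e\phi}{12}+\frac{\phi W^bW^e\nabla_eY_b}{12\rho}+\frac{\ell W^eY^a\nabla_eY_a}{6\rho}+\mathrm{P}_{ae}W^eY^a+\frac{Y^e\nabla_e\ell}{6}+\frac{\phi W^eY^a\nabla_aW_e}{12\rho}-\frac{\ell\phi}{18}+\frac{\ell Y^bY^a\nabla_aW_b}{6\rho}.$$ $\mathrm{Res}(P(t),Q(t))$ denotes the resultant of the polynomials $P$ and $Q$ in the single variable $t$ (computed pointwise on $M$). *)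

theory Defs
  imports "HOL-Analysis.Analysis" "Subresultants.Resultant_Prelim"
begin

section \<open>Smooth functions on open subsets of the plane\<close>

type_synonym coord = "real^2"
type_synonym scalar = "coord \<Rightarrow> real"
type_synonym tensor1 = "2 \<Rightarrow> scalar"
type_synonym tensor2 = "2 \<Rightarrow> 2 \<Rightarrow> scalar"
type_synonym tensor3 = "2 \<Rightarrow> 2 \<Rightarrow> 2 \<Rightarrow> scalar"

definition partial :: "2 \<Rightarrow> scalar \<Rightarrow> scalar" (\<open>\<partial>\<close>) where
  "\<partial> a f x = frechet_derivative f (at x) (axis a 1)"

primrec Ck_on :: "nat \<Rightarrow> coord set \<Rightarrow> scalar \<Rightarrow> bool" where
  "Ck_on 0 U f \<longleftrightarrow> continuous_on U f"
| "Ck_on (Suc k) U f \<longleftrightarrow> f differentiable_on U \<and> (\<forall>a. Ck_on k U (\<partial> a f))"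

definition smooth_on :: "coord set \<Rightarrow> scalar \<Rightarrow> bool" where
  "smooth_on U f \<longleftrightarrow> (\<forall>k. Ck_on k U f)"

section \<open>Smooth surfaces\<close>

type_synonym 'm chart = "'m set \<times> ('m \<Rightarrow> coord)"

abbreviation chart_dom :: "'m chart \<Rightarrow> 'm set" where "chart_dom \<equiv> fst"
abbreviation chart_map :: "'m chart \<Rightarrow> 'm \<Rightarrow> coord" where "chart_map \<equiv> snd"

definition chart_range :: "'m chart \<Rightarrow> coord set" where
  "chart_range c = chart_map c ` chart_dom c"

definition overlap :: "'m chart \<Rightarrow> 'm chart \<Rightarrow> coord set" where
  "overlap c c' = chart_map c ` (chart_dom c \<inter> chart_dom c')"

text \<open>The change of coordinates from the chart \<open>c\<close> to the chart \<open>c'\<close>, meaningful only on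
  \<open>overlap c c'\<close>.\<close>

definition transition :: "'m chart \<Rightarrow> 'm chart \<Rightarrow> coord \<Rightarrow> coord" where
  "transition c c' x = chart_map c' (inv_into (chart_dom c) (chart_map c) x)"

definition trans_comp :: "'m chart \<Rightarrow> 'm chart \<Rightarrow> 2 \<Rightarrow> scalar" where
  "trans_comp c c' i x = vec_nth (transition c c' x) i"

definition smooth_surface :: "'m topology \<Rightarrow> 'm chart set \<Rightarrow> bool" where
  "smooth_surface M A \<longleftrightarrow>
     Hausdorff_space M \<and> second_countable M \<and>
     (\<Union>c\<in>A. chart_dom c) = topspace M \<and>
     (\<forall>c\<in>A. openin M (chart_dom c) \<and> open (chart_range c) \<and>
        homeomorphic_map (subtopology M (chart_dom c)) (top_of_set (chart_range c)) (chart_map c)) \<and>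
     (\<forall>c\<in>A. \<forall>c'\<in>A. \<forall>i. smooth_on (overlap c c') (trans_comp c c' i))"

section \<open>Tensor fields and connections\<close>

text \<open>A field on a surface is given by its components in every chart of the atlas, as functions of
  the coordinates, subject to the usual transformation law on overlaps. Values outside
  \<open>chart_range c\<close> are irrelevant.\<close>

definition one_form :: "'m chart set \<Rightarrow> ('m chart \<Rightarrow> tensor1) \<Rightarrow> bool" where
  "one_form A \<omega> \<longleftrightarrow>
     (\<forall>c\<in>A. \<forall>a. smooth_on (chart_range c) (\<omega> c a)) \<and>
     (\<forall>c\<in>A. \<forall>c'\<in>A. \<forall>x\<in>overlap c c'. \<forall>a.
        \<omega> c a x = (\<Sum>i\<in>UNIV. \<partial> a (trans_comp c c' i) x * \<omega> c' i (transition c c' x)))"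

definition volume_form :: "'m chart set \<Rightarrow> ('m chart \<Rightarrow> tensor2) \<Rightarrow> bool" where
  "volume_form A \<epsilon> \<longleftrightarrow>
     (\<forall>c\<in>A. \<forall>a b. smooth_on (chart_range c) (\<epsilon> c a b)) \<and>
     (\<forall>c\<in>A. \<forall>x\<in>chart_range c. (\<forall>a b. \<epsilon> c a b x = - \<epsilon> c b a x) \<and> \<epsilon> c 1 2 x \<noteq> 0) \<and>
     (\<forall>c\<in>A. \<forall>c'\<in>A. \<forall>x\<in>overlap c c'. \<forall>a b.
        \<epsilon> c a b x = (\<Sum>i\<in>UNIV. \<Sum>j\<in>UNIV.
          \<partial> a (trans_comp c c' i) x * \<partial> b (trans_comp c c' j) x * \<epsilon> c' i j (transition c c' x)))"

text \<open>\<open>D c k a b\<close> is the Christoffel symbol \<open>\<Gamma>\<^sup>k\<^sub>a\<^sub>b\<close> of the connection \<open>D\<close> in the chart \<open>c\<close>, where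
  \<open>\<nabla>\<^sub>a X\<^sup>k = \<partial>\<^sub>a X\<^sup>k + \<Gamma>\<^sup>k\<^sub>a\<^sub>b X\<^sup>b\<close>.\<close>

definition torsion_free_connection :: "'m chart set \<Rightarrow> ('m chart \<Rightarrow> tensor3) \<Rightarrow> bool" where
  "torsion_free_connection A D \<longleftrightarrow>
     (\<forall>c\<in>A. \<forall>k a b. smooth_on (chart_range c) (D c k a b)) \<and>
     (\<forall>c\<in>A. \<forall>x\<in>chart_range c. \<forall>k a b. D c k a b x = D c k b a x) \<and>
     (\<forall>c\<in>A. \<forall>c'\<in>A. \<forall>x\<in>overlap c c'. \<forall>k a b.
        (\<Sum>e\<in>UNIV. \<partial> e (trans_comp c c' k) x * D c e a b x) =
        \<partial> a (\<partial> b (trans_comp c c' k)) x +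
        (\<Sum>i\<in>UNIV. \<Sum>j\<in>UNIV. D c' k i j (transition c c' x) *
            \<partial> a (trans_comp c c' i) x * \<partial> b (trans_comp c c' j) x))"

text \<open>Covariant derivatives in a chart with Christoffel symbols \<open>G\<close>. The first index of the
  result is the differentiation index: \<open>nabla_vec G X a k = \<nabla>\<^sub>a X\<^sup>k\<close>, \<open>nabla_form G \<omega> a b = \<nabla>\<^sub>a \<omega>\<^sub>b\<close>,
  \<open>nabla_bilin G T a b d = \<nabla>\<^sub>a T\<^sub>b\<^sub>d\<close>.\<close>

definition nabla_vec :: "tensor3 \<Rightarrow> tensor1 \<Rightarrow> tensor2" where
  "nabla_vec G X a k x = \<partial> a (X k) x + (\<Sum>b\<in>UNIV. G k a b x * X b x)"

definition nabla_form :: "tensor3 \<Rightarrow> tensor1 \<Rightarrow> tensor2" where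
  "nabla_form G \<omega> a b x = \<partial> a (\<omega> b) x - (\<Sum>e\<in>UNIV. G e a b x * \<omega> e x)"

definition nabla_bilin :: "tensor3 \<Rightarrow> tensor2 \<Rightarrow> tensor3" where
  "nabla_bilin G T a b d x =
     \<partial> a (T b d) x - (\<Sum>e\<in>UNIV. G e a b x * T e d x) - (\<Sum>e\<in>UNIV. G e a d x * T b e x)"

definition projective_equivalence ::
    "'m chart set \<Rightarrow> (('m chart \<Rightarrow> tensor3) \<times> ('m chart \<Rightarrow> tensor3)) set" where
  "projective_equivalence A = {(D, D').
     torsion_free_connection A D \<and> torsion_free_connection A D' \<and>
     (\<exists>\<Upsilon>. one_form A \<Upsilon> \<and>
       (\<forall>\<omega>. one_form A \<omega> \<longrightarrow> (\<forall>c\<in>A. \<forall>x\<in>chart_range c. \<forall>a b.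
          nabla_form (D' c) (\<omega> c) a b x =
          nabla_form (D c) (\<omega> c) a b x - \<Upsilon> c a x * \<omega> c b x - \<Upsilon> c b x * \<omega> c a x)))}"

definition projective_structure :: "'m chart set \<Rightarrow> ('m chart \<Rightarrow> tensor3) set \<Rightarrow> bool" where
  "projective_structure A S \<longleftrightarrow>
     S \<in> {D. torsion_free_connection A D} // projective_equivalence A"

definition parallel_volume ::
    "'m chart set \<Rightarrow> ('m chart \<Rightarrow> tensor3) \<Rightarrow> ('m chart \<Rightarrow> tensor2) \<Rightarrow> bool" where
  "parallel_volume A D \<epsilon> \<longleftrightarrow>
     (\<forall>c\<in>A. \<forall>x\<in>chart_range c. \<forall>a b d. nabla_bilin (D c) (\<epsilon> c) a b d x = 0)"

section \<open>Curvature\<close>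

text \<open>\<open>curv G a b k d\<close> is \<open>R\<^sub>a\<^sub>b\<^sup>k\<^sub>d\<close> with \<open>(\<nabla>\<^sub>a \<nabla>\<^sub>b - \<nabla>\<^sub>b \<nabla>\<^sub>a) X\<^sup>k = R\<^sub>a\<^sub>b\<^sup>k\<^sub>d X\<^sup>d\<close>
  (torsion-free case): apply the identity to the coordinate field \<open>X = \<partial>\<^sub>d\<close>.\<close>

definition curv :: "tensor3 \<Rightarrow> 2 \<Rightarrow> 2 \<Rightarrow> 2 \<Rightarrow> 2 \<Rightarrow> scalar" where
  "curv G a b k d x =
     \<partial> a (G k b d) x - \<partial> b (G k a d) x
     + (\<Sum>e\<in>UNIV. G k a e x * G e b d x) - (\<Sum>e\<in>UNIV. G k b e x * G e a d x)"

definition ricci :: "tensor3 \<Rightarrow> tensor2" where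
  "ricci G a b x = (\<Sum>c\<in>UNIV. curv G c a c b x)"

text \<open>The projective rho tensor \<open>n / (n\<^sup>2 - 1) R\<^sub>a\<^sub>b + 1 / (n\<^sup>2 - 1) R\<^sub>b\<^sub>a\<close> for \<open>n = 2\<close>.\<close>

definition rho_tensor :: "tensor3 \<Rightarrow> tensor2" where
  "rho_tensor G a b x = 2/3 * ricci G a b x + 1/3 * ricci G b a x"

definition pEW_solution ::
    "'m chart set \<Rightarrow> ('m chart \<Rightarrow> tensor3) \<Rightarrow> ('m chart \<Rightarrow> tensor1) \<Rightarrow> bool" where
  "pEW_solution A D \<alpha> \<longleftrightarrow> one_form A \<alpha> \<and>
     (\<forall>c\<in>A. \<forall>x\<in>chart_range c. \<forall>a b.
        (nabla_form (D c) (\<alpha> c) a b x + nabla_form (D c) (\<alpha> c) b a x) / 2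
        + \<alpha> c a x * \<alpha> c b x
        + (rho_tensor (D c) a b x + rho_tensor (D c) b a x) / 2 = 0)"

section \<open>Invariants of a projective surface with volume form\<close>

text \<open>Everything below is written in the coordinates of one chart, in terms of the Christoffel symbols
  \<open>G\<close> and the components \<open>E\<close> of the volume form. All expressions are tensorial, so the scalars
  \<open>phi\<close>, \<open>rho\<close>, \<open>ell\<close> and the polynomials \<open>P1\<close>, \<open>P2\<close>, \<open>P3\<close> take the same value at a given point of the
  surface in every chart.\<close>

locale unimodular_chart =
  fixes G :: tensor3 and E :: tensor2
begin

text \<open>The inverse \<open>\<epsilon>\<^sup>a\<^sup>b\<close> of \<open>\<epsilon>\<^sub>a\<^sub>b\<close>: its only nonzero components are \<open>\<plusminus>1 / \<epsilon>\<^sub>1\<^sub>2\<close>;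
  see \<open>E_inv_normalized\<close> below.\<close>

definition E_inv :: tensor2 where
  "E_inv a b x = E a b x / (E 1 2 x)\<^sup>2"

definition raise :: "tensor1 \<Rightarrow> tensor1" where
  "raise V a x = (\<Sum>b\<in>UNIV. E_inv a b x * V b x)"

definition lower :: "tensor1 \<Rightarrow> tensor1" where
  "lower V b x = (\<Sum>a\<in>UNIV. V a x * E a b x)"

abbreviation P :: tensor2 where "P \<equiv> rho_tensor G"

definition cotton_york :: tensor3 where
  "cotton_york a b c x = nabla_bilin G P a b c x - nabla_bilin G P b a c x"

definition Y_low :: tensor1 where
  "Y_low a x = (\<Sum>b\<in>UNIV. \<Sum>c\<in>UNIV. E_inv b c x * cotton_york b c a x)"

definition Y :: tensor1 where "Y = raise Y_low"

definition divergence :: "tensor1 \<Rightarrow> scalar" where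
  "divergence X x = (\<Sum>a\<in>UNIV. nabla_vec G X a a x)"

definition deriv_along :: "tensor1 \<Rightarrow> scalar \<Rightarrow> scalar" where
  "deriv_along X f x = (\<Sum>a\<in>UNIV. X a x * \<partial> a f x)"

text \<open>\<open>nabla_contr X Z \<omega> = X\<^sup>e Z\<^sup>d \<nabla>\<^sub>e \<omega>\<^sub>d\<close>: the first vector contracts with the differentiation index.\<close>

definition nabla_contr :: "tensor1 \<Rightarrow> tensor1 \<Rightarrow> tensor1 \<Rightarrow> scalar" where
  "nabla_contr X Z \<omega> x = (\<Sum>e\<in>UNIV. \<Sum>d\<in>UNIV. X e x * Z d x * nabla_form G \<omega> e d x)"

definition P_contr :: "tensor1 \<Rightarrow> tensor1 \<Rightarrow> scalar" where
  "P_contr X Z x = (\<Sum>a\<in>UNIV. \<Sum>b\<in>UNIV. P a b x * X a x * Z b x)"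

definition phi :: scalar where
  "phi x = 2 * divergence Y x"

definition W :: tensor1 where
  "W a x = (\<Sum>b\<in>UNIV. Y b x * nabla_vec G Y b a x) - 2 * phi x / 3 * Y a x"

definition W_low :: tensor1 where "W_low = lower W"

definition rho :: scalar where
  "rho x = (\<Sum>a\<in>UNIV. Y_low a x * W a x)"

definition ell :: scalar where
  "ell x = 5 * (phi x)\<^sup>2 / 12 + 3 * P_contr Y Y x - deriv_along Y phi x / 2"

definition a1 :: scalar where
  "a1 x = 15 * (deriv_along Y rho x / rho x - 5 * phi x / 2)"

definition a2 :: scalar where
  "a2 x = - (3 * deriv_along W rho x / rho x + 6 * ell x - 3 * divergence W x)"

definition a3 :: scalar where
  "a3 x = deriv_along W phi x / 2 + phi x / 2 * divergence W x + deriv_along Y ell x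
     + phi x * ell x / 2 - phi x * deriv_along W rho x / (2 * rho x)
     - ell x * (deriv_along Y rho x / rho x)"

definition b1 :: scalar where
  "b1 x = - (5 * nabla_contr W Y W_low x / rho x) + 50 * ell x / 3"

definition b2 :: scalar where
  "b2 x = nabla_contr W W W_low x / rho x"

definition b3 :: scalar where
  "b3 x = phi x * nabla_contr W W W_low x / (6 * rho x) + P_contr W W x + (ell x)\<^sup>2 / 9
     + ell x * nabla_contr W Y W_low x / (3 * rho x) + deriv_along W ell x / 3"

definition c1 :: scalar where
  "c1 x = - (5 * (nabla_contr W Y Y_low x + nabla_contr Y Y W_low x) / (2 * rho x))
     - 25 * phi x / 6"

definition c2 :: scalar where
  "c2 x = 2 * ell x / 3 + (nabla_contr W W Y_low x + nabla_contr Y W W_low x) / (2 * rho x)"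

definition c3 :: scalar where
  "c3 x = - (deriv_along W phi x / 12) + phi x * nabla_contr W W Y_low x / (12 * rho x)
     + ell x * nabla_contr W Y Y_low x / (6 * rho x) + P_contr W Y x + deriv_along Y ell x / 6
     + phi x * nabla_contr Y W W_low x / (12 * rho x) - ell x * phi x / 18
     + ell x * nabla_contr Y Y W_low x / (6 * rho x)"

definition P1 :: "coord \<Rightarrow> real poly" where
  "P1 x = monom (-90) 6 + monom (a1 x) 4 + monom (a2 x) 2 + monom (- 9 * rho x) 1 + monom (a3 x) 0"

definition P2 :: "coord \<Rightarrow> real poly" where
  "P2 x = monom (-275) 8 + monom (b1 x) 4 + monom (20 * rho x) 3 + monom (b2 x) 2 + monom (b3 x) 0"

definition P3 :: "coord \<Rightarrow> real poly" where
  "P3 x = monom (-40) 6 + monom (c1 x) 4 + monom (c2 x) 2 + monom (rho x) 1 + monom (c3 x) 0"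

lemma E_inv_normalized:
  assumes skew: "\<And>a b. E a b x = - E b a x" and nz: "E 1 2 x \<noteq> 0"
  shows "(\<Sum>c\<in>UNIV. E_inv a c x * E b c x) = (if a = b then 1 else 0)"
    and "(\<Sum>a\<in>UNIV. \<Sum>b\<in>UNIV. E_inv a b x * E a b x) = 2"
proof -
  have e: "E 1 1 x = 0" "E 2 2 x = 0" "E 2 1 x = - E 1 2 x"
    using skew[of 1 1] skew[of 2 2] skew[of 2 1] by auto
  have sq: "E 1 2 x * E 1 2 x = (E 1 2 x)\<^sup>2" by (simp add: power2_eq_square)
  show "(\<Sum>c\<in>UNIV. E_inv a c x * E b c x) = (if a = b then 1 else 0)"
    using exhaust_2[of a] exhaust_2[of b] nz
    by (auto simp: E_inv_def sum_2 e sq)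
  show "(\<Sum>a\<in>UNIV. \<Sum>b\<in>UNIV. E_inv a b x * E a b x) = 2"
    using nz by (simp add: E_inv_def sum_2 e sq)
qed

end

end

theory Submission
  imports Defs "HOL-Computational_Algebra.Field_as_Ring" "Subresultants.Subresultant_Gcd"
begin

text \<open>
  The three polynomials have a common real root at every point, namely twice the coefficient \<open>F\<close> of
  the skew part of \<open>\<nabla>\<alpha>\<close>; and a common root makes a resultant vanish. The root appears when the
  pEW equation is prolonged. Write \<open>\<nabla>\<^sub>a \<alpha>\<^sub>b = - \<alpha>\<^sub>a \<alpha>\<^sub>b - P\<^sub>a\<^sub>b + F \<epsilon>\<^sub>a\<^sub>b\<close>. Commuting derivatives on \<open>\<alpha>\<close>
  gives \<open>\<nabla>\<^sub>a F = - 3 F \<alpha>\<^sub>a - Y\<^sub>a / 2\<close> (\<open>partial_F\<close>), so the system for \<open>(\<alpha>, F)\<close> is closed, and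
  every further identity is an algebraic constraint. Commuting derivatives on \<open>F\<close> gives the first one,
  \<open>Y\<^sup>a \<alpha>\<^sub>a = - 4 F\<^sup>2 - \<phi> / 6\<close> (\<open>pair_Y\<close>), and its derivative along \<open>Y\<close> gives the second,
  \<open>W\<^sup>a \<alpha>\<^sub>a = - 80 F\<^sup>4 + \<ell> / 3\<close> (\<open>pair_W\<close>); the definitions of \<open>W\<close> and \<open>\<ell>\<close> are made for this.

  As \<open>\<rho> \<noteq> 0\<close>, the fields \<open>Y\<close> and \<open>W\<close> form a frame, so that the two constraints determine \<open>\<alpha>\<close> in
  terms of \<open>F\<close> and of invariants of the surface. Three derivatives of the constraints
  remain: \<open>W\<close> of the first, \<open>Y\<close> of the second and \<open>W\<close> of the second. Once \<open>\<alpha>\<close> is eliminated they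
  are polynomial equations for \<open>F\<close> (\<open>pair_derivatives\<close>). In \<open>t = 2 F\<close>, the last one is
  \<open>P\<^sub>2(t) = 0\<close>, and the difference and the sum of the other two are multiples of \<open>P\<^sub>1(t) = 0\<close> and
  \<open>P\<^sub>3(t) = 0\<close>. The difference involves only skew combinations of covariant derivatives,
  which is why \<open>P\<^sub>1\<close> can be written with divergences and derivatives of \<open>\<rho>\<close>.

  All of this happens in a single chart, with partial derivatives and Christoffel symbols; the tensor
  calculus rests on the product rule for \<open>\<partial>\<close> and on the symmetry of second partial derivatives.
\<close>

section \<open>Calculus of smooth functions on an open subset of the plane\<close>

lemma partial_eqI:
  assumes "(f has_derivative f') (at x)"
  shows "\<partial> a f x = f' (axis a 1)"
  using frechet_derivative_at[OF assms] by (simp add: partial_def)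

lemma partial_const: "\<partial> a (\<lambda>x. k) = (\<lambda>x. 0)"
  by (rule ext, rule partial_eqI) (rule has_derivative_const)

lemma partial_add:
  assumes "f differentiable at x" "g differentiable at x"
  shows "\<partial> a (\<lambda>x. f x + g x) x = \<partial> a f x + \<partial> a g x"
proof -
  have "((\<lambda>x. f x + g x) has_derivative
      (\<lambda>h. frechet_derivative f (at x) h + frechet_derivative g (at x) h)) (at x)"
    by (rule has_derivative_add) (use assms frechet_derivative_works in blast)+
  from partial_eqI[OF this] show ?thesis by (simp add: partial_def)
qed

lemma partial_diff:
  assumes "f differentiable at x" "g differentiable at x"
  shows "\<partial> a (\<lambda>x. f x - g x) x = \<partial> a f x - \<partial> a g x"
proof -
  have "((\<lambda>x. f x - g x) has_derivative
      (\<lambda>h. frechet_derivative f (at x) h - frechet_derivative g (at x) h)) (at x)"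
    by (rule has_derivative_diff) (use assms frechet_derivative_works in blast)+
  from partial_eqI[OF this] show ?thesis by (simp add: partial_def)
qed

lemma partial_mult:
  assumes "f differentiable at x" "g differentiable at x"
  shows "\<partial> a (\<lambda>x. f x * g x) x = \<partial> a f x * g x + f x * \<partial> a g x"
proof -
  have "((\<lambda>x. f x * g x) has_derivative
      (\<lambda>h. f x * frechet_derivative g (at x) h + frechet_derivative f (at x) h * g x)) (at x)"
    by (rule has_derivative_mult) (use assms frechet_derivative_works in blast)+
  from partial_eqI[OF this] show ?thesis by (simp add: partial_def)
qed

lemma partial_inverse:
  assumes "f differentiable at x" "f x \<noteq> 0"
  shows "\<partial> a (\<lambda>x. inverse (f x)) x = - \<partial> a f x / (f x)\<^sup>2"
proof -
  have "((\<lambda>x. inverse (f x)) has_derivative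
      (\<lambda>h. - (inverse (f x) * frechet_derivative f (at x) h * inverse (f x)))) (at x)"
    by (rule Deriv.has_derivative_inverse) (use assms frechet_derivative_works in blast)+
  from partial_eqI[OF this] show ?thesis by (simp add: partial_def field_simps power2_eq_square)
qed

lemma partial_cong:
  assumes "open U" "x \<in> U" "\<And>y. y \<in> U \<Longrightarrow> f y = g y"
  shows "\<partial> a f x = \<partial> a g x"
proof -
  have "(f has_derivative f') (at x) \<longleftrightarrow> (g has_derivative f') (at x)" for f'
    using assms has_derivative_transform_within_open[of f _ x UNIV U g]
      has_derivative_transform_within_open[of g _ x UNIV U f] by auto
  then show ?thesis by (simp add: partial_def frechet_derivative_def)
qed

lemma Ck_on_cong:
  assumes "open U" "\<And>y. y \<in> U \<Longrightarrow> f y = g y" "Ck_on k U f"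
  shows "Ck_on k U g"
  using assms(2,3)
proof (induction k arbitrary: f g)
  case 0
  then show ?case using continuous_on_cong by force
next
  case (Suc k)
  have "g differentiable_on U"
    unfolding differentiable_on_def
  proof
    fix x assume x: "x \<in> U"
    with Suc.prems(2) have "f differentiable at x within U"
      by (simp add: differentiable_on_def)
    then show "g differentiable at x within U"
      by (rule differentiable_transform_within[where d = 1]) (simp_all add: x Suc.prems(1))
  qed
  moreover have "Ck_on k U (\<partial> a g)" for a
    using Suc.IH[of "\<partial> a f" "\<partial> a g"] partial_cong[OF assms(1) _ Suc.prems(1)] Suc.prems(2) by auto
  ultimately show ?case by simp
qed

lemma Ck_on_Suc_imp: "Ck_on (Suc k) U f \<Longrightarrow> Ck_on k U f"
  by (induction k arbitrary: f) (auto intro: differentiable_imp_continuous_on)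

lemma smooth_on_partial: "smooth_on U f \<Longrightarrow> smooth_on U (\<partial> a f)"
  unfolding smooth_on_def by (metis Ck_on.simps(2))

lemma DERIV_along_axis:
  assumes "f differentiable at (p + s *\<^sub>R axis a 1)"
  shows "((\<lambda>s. f (p + s *\<^sub>R axis a 1)) has_real_derivative \<partial> a f (p + s *\<^sub>R axis a 1)) (at s)"
proof -
  let ?q = "p + s *\<^sub>R axis a 1"
  let ?D = "frechet_derivative f (at ?q)"
  have f: "(f has_derivative ?D) (at ?q)"
    using assms frechet_derivative_works by blast
  then have lin: "?D (h *\<^sub>R axis a 1) = h * ?D (axis a 1)" for h
    by (simp add: has_derivative_linear linear_scale)
  have "((\<lambda>s. f (p + s *\<^sub>R axis a 1)) has_derivative (\<lambda>h. ?D (h *\<^sub>R axis a 1))) (at s)"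
    by (rule has_derivative_compose[of "\<lambda>s. p + s *\<^sub>R axis a 1", OF _ f])
      (auto intro!: derivative_eq_intros)
  then show ?thesis
    by (simp add: has_field_derivative_def partial_def lin mult_commute_abs)
qed

context
  fixes U :: "coord set"
  assumes U: "open U"
begin

lemma Ck_on_differentiable_at: "Ck_on (Suc k) U f \<Longrightarrow> x \<in> U \<Longrightarrow> f differentiable at x"
  by (simp add: differentiable_on_eq_differentiable_at[OF U])

lemma Ck_on_const: "Ck_on k U (\<lambda>x. c)"
  by (induction k arbitrary: c) (auto simp: partial_const)

lemma Ck_on_add: "Ck_on k U f \<Longrightarrow> Ck_on k U g \<Longrightarrow> Ck_on k U (\<lambda>x. f x + g x)"
proof (induction k arbitrary: f g)
  case 0
  then show ?case by (simp add: continuous_on_add)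
next
  case (Suc k)
  have sum: "Ck_on k U (\<lambda>x. \<partial> a f x + \<partial> a g x)" for a
    using Suc.prems by (intro Suc.IH) simp_all
  have eq: "\<partial> a f x + \<partial> a g x = \<partial> a (\<lambda>x. f x + g x) x" if "x \<in> U" for a x
    by (intro partial_add[symmetric] Ck_on_differentiable_at[OF _ that]) (fact Suc.prems)+
  have "Ck_on k U (\<partial> a (\<lambda>x. f x + g x))" for a
    by (rule Ck_on_cong[OF U eq sum])
  moreover have "(\<lambda>x. f x + g x) differentiable_on U"
    using Suc.prems by (simp add: differentiable_on_add)
  ultimately show ?case by simp
qed

lemma Ck_on_mult: "Ck_on k U f \<Longrightarrow> Ck_on k U g \<Longrightarrow> Ck_on k U (\<lambda>x. f x * g x)"
proof (induction k arbitrary: f g)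
  case 0
  then show ?case by (simp add: continuous_on_mult)
next
  case (Suc k)
  have sum: "Ck_on k U (\<lambda>x. \<partial> a f x * g x + f x * \<partial> a g x)" for a
    using Suc.prems Ck_on_Suc_imp[OF Suc.prems(1)] Ck_on_Suc_imp[OF Suc.prems(2)]
    by (intro Ck_on_add Suc.IH) simp_all
  have eq: "\<partial> a f x * g x + f x * \<partial> a g x = \<partial> a (\<lambda>x. f x * g x) x" if "x \<in> U" for a x
    by (intro partial_mult[symmetric] Ck_on_differentiable_at[OF _ that]) (fact Suc.prems)+
  have "Ck_on k U (\<partial> a (\<lambda>x. f x * g x))" for a
    by (rule Ck_on_cong[OF U eq sum])
  moreover have "(\<lambda>x. f x * g x) differentiable_on U"
    unfolding differentiable_on_eq_differentiable_at[OF U]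
    using Ck_on_differentiable_at[OF Suc.prems(1)] Ck_on_differentiable_at[OF Suc.prems(2)]
    by (simp add: differentiable_mult)
  ultimately show ?case by simp
qed

lemma Ck_on_inverse:
  assumes nz: "\<And>x. x \<in> U \<Longrightarrow> f x \<noteq> 0"
  shows "Ck_on k U f \<Longrightarrow> Ck_on k U (\<lambda>x. inverse (f x))"
proof (induction k)
  case 0
  then show ?case by (simp add: continuous_on_inverse nz)
next
  case (Suc k)
  have k: "Ck_on k U (\<lambda>x. inverse (f x))" "\<And>a. Ck_on k U (\<partial> a f)"
    using Suc.IH[OF Ck_on_Suc_imp[OF Suc.prems]] Suc.prems by simp_all
  have eq: "(-1) * (\<partial> a f x * (inverse (f x) * inverse (f x))) = \<partial> a (\<lambda>x. inverse (f x)) x"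
    if x: "x \<in> U" for a x
    by (subst partial_inverse[OF Ck_on_differentiable_at[OF Suc.prems x] nz[OF x]])
      (simp add: divide_inverse power2_eq_square)
  have "Ck_on k U (\<lambda>x. (-1) * (\<partial> a f x * (inverse (f x) * inverse (f x))))" for a
    using k by (intro Ck_on_mult Ck_on_const)
  then have "Ck_on k U (\<partial> a (\<lambda>x. inverse (f x)))" for a
    by (rule Ck_on_cong[OF U eq, rotated])
  moreover have "(\<lambda>x. inverse (f x)) differentiable_on U"
    unfolding differentiable_on_eq_differentiable_at[OF U]
    using Ck_on_differentiable_at[OF Suc.prems] nz by (simp add: differentiable_inverse)
  ultimately show ?case by simp
qed

lemma smooth_on_differentiable_at: "smooth_on U f \<Longrightarrow> x \<in> U \<Longrightarrow> f differentiable at x"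
  using Ck_on_differentiable_at smooth_on_def by blast

lemma smooth_on_const: "smooth_on U (\<lambda>x. c)"
  by (simp add: smooth_on_def Ck_on_const)

lemma smooth_on_add: "smooth_on U f \<Longrightarrow> smooth_on U g \<Longrightarrow> smooth_on U (\<lambda>x. f x + g x)"
  by (simp add: smooth_on_def Ck_on_add)

lemma smooth_on_mult: "smooth_on U f \<Longrightarrow> smooth_on U g \<Longrightarrow> smooth_on U (\<lambda>x. f x * g x)"
  by (simp add: smooth_on_def Ck_on_mult)

lemma smooth_on_minus: "smooth_on U f \<Longrightarrow> smooth_on U (\<lambda>x. - f x)"
  using smooth_on_mult[OF smooth_on_const[of "-1"]] by simp

lemma smooth_on_diff: "smooth_on U f \<Longrightarrow> smooth_on U g \<Longrightarrow> smooth_on U (\<lambda>x. f x - g x)"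
  using smooth_on_add[OF _ smooth_on_minus] by simp

lemma smooth_on_power: "smooth_on U f \<Longrightarrow> smooth_on U (\<lambda>x. f x ^ n)"
  by (induction n) (simp_all add: smooth_on_const smooth_on_mult)

lemma smooth_on_divide:
  "smooth_on U f \<Longrightarrow> smooth_on U g \<Longrightarrow> (\<And>x. x \<in> U \<Longrightarrow> g x \<noteq> 0) \<Longrightarrow> smooth_on U (\<lambda>x. f x / g x)"
  unfolding divide_inverse smooth_on_def by (simp add: Ck_on_mult Ck_on_inverse)

lemma smooth_on_sum: "(\<And>i. i \<in> I \<Longrightarrow> smooth_on U (f i)) \<Longrightarrow> smooth_on U (\<lambda>x. \<Sum>i\<in>I. f i x)"
  by (induction I rule: infinite_finite_induct) (simp_all add: smooth_on_const smooth_on_add)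

text \<open>
  Two applications of the one-variable mean value theorem, first in direction \<open>a\<close> and then in
  direction \<open>b\<close>. The second difference on the left is symmetric in \<open>a\<close> and \<open>b\<close>, whereas the
  order of differentiation on the right is not.
\<close>

lemma second_difference_mean_value:
  assumes f: "Ck_on 2 U f" and h: "0 < h"
    and sub: "\<And>s t. 0 \<le> s \<Longrightarrow> s \<le> h \<Longrightarrow> 0 \<le> t \<Longrightarrow> t \<le> h \<Longrightarrow> x + s *\<^sub>R axis a 1 + t *\<^sub>R axis b 1 \<in> U"
  obtains s t where "0 < s" "s < h" "0 < t" "t < h"
    "f (x + h *\<^sub>R axis a 1 + h *\<^sub>R axis b 1) - f (x + h *\<^sub>R axis a 1) - f (x + h *\<^sub>R axis b 1) + f x
      = h\<^sup>2 * \<partial> b (\<partial> a f) (x + s *\<^sub>R axis a 1 + t *\<^sub>R axis b 1)"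
proof -
  let ?u = "axis a 1 :: coord" and ?v = "axis b 1 :: coord"
  have f1: "f differentiable at y" and f2: "\<partial> a f differentiable at y" if "y \<in> U" for y
    using f that by (auto simp: numeral_2_eq_2 differentiable_on_eq_differentiable_at[OF U])
  have "((\<lambda>s. f (x + s *\<^sub>R ?u + h *\<^sub>R ?v) - f (x + s *\<^sub>R ?u)) has_real_derivative
      \<partial> a f (x + s *\<^sub>R ?u + h *\<^sub>R ?v) - \<partial> a f (x + s *\<^sub>R ?u)) (at s)" if "0 \<le> s" "s \<le> h" for s
    using DERIV_along_axis[of f "x + h *\<^sub>R ?v" s a] DERIV_along_axis[of f x s a] h
      f1[OF sub[of s h]] f1[OF sub[of s 0]] that
    by (intro derivative_intros) (auto simp: algebra_simps)
  from MVT2[OF h this] obtain s where s: "0 < s" "s < h"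
    "f (x + h *\<^sub>R ?u + h *\<^sub>R ?v) - f (x + h *\<^sub>R ?u) - (f (x + h *\<^sub>R ?v) - f x)
      = h * (\<partial> a f (x + s *\<^sub>R ?u + h *\<^sub>R ?v) - \<partial> a f (x + s *\<^sub>R ?u))" by auto
  have "((\<lambda>t. \<partial> a f (x + s *\<^sub>R ?u + t *\<^sub>R ?v)) has_real_derivative
      \<partial> b (\<partial> a f) (x + s *\<^sub>R ?u + t *\<^sub>R ?v)) (at t)" if "0 \<le> t" "t \<le> h" for t
    using s that by (intro DERIV_along_axis f2 sub) auto
  from MVT2[OF h this] obtain t where t: "0 < t" "t < h"
    "\<partial> a f (x + s *\<^sub>R ?u + h *\<^sub>R ?v) - \<partial> a f (x + s *\<^sub>R ?u)
      = h * \<partial> b (\<partial> a f) (x + s *\<^sub>R ?u + t *\<^sub>R ?v)" by auto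
  show thesis
    by (rule that[OF s(1,2) t(1,2)]) (use s(3) t(3) in \<open>simp add: power2_eq_square\<close>)
qed

text \<open>
  The second difference over a small square equals \<open>h\<^sup>2\<close> times either mixed derivative, each at some
  point of the square. By continuity both values are close to those at the corner \<open>x\<close>.
\<close>

lemma partial_commute:
  assumes f: "Ck_on 2 U f" and x: "x \<in> U"
  shows "\<partial> a (\<partial> b f) x = \<partial> b (\<partial> a f) x"
proof (rule ccontr)
  assume neq: "\<partial> a (\<partial> b f) x \<noteq> \<partial> b (\<partial> a f) x"
  define \<epsilon> where "\<epsilon> = \<bar>\<partial> a (\<partial> b f) x - \<partial> b (\<partial> a f) x\<bar> / 2"
  have "\<epsilon> > 0" using neq by (simp add: \<epsilon>_def)
  have "isCont (\<partial> a (\<partial> b f)) x" "isCont (\<partial> b (\<partial> a f)) x"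
    using f x U by (auto simp: numeral_2_eq_2 continuous_on_eq_continuous_at)
  then obtain d1 d2 where d: "d1 > 0" "d2 > 0"
    "\<And>y. dist y x < d1 \<Longrightarrow> dist (\<partial> a (\<partial> b f) y) (\<partial> a (\<partial> b f) x) < \<epsilon>"
    "\<And>y. dist y x < d2 \<Longrightarrow> dist (\<partial> b (\<partial> a f) y) (\<partial> b (\<partial> a f) x) < \<epsilon>"
    using \<open>\<epsilon> > 0\<close> unfolding continuous_at_eps_delta by metis
  obtain r where r: "r > 0" "ball x r \<subseteq> U" using U x open_contains_ball by blast
  \<comment> \<open>A square with side \<open>h\<close> has diameter at most \<open>2 h\<close>, which is less than each of the three radii.\<close>
  define h where "h = Min {d1, d2, r} / 3"
  have "Min {d1, d2, r} > 0" using d r by simp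
  then have h: "h > 0" "3 * h \<le> d1" "3 * h \<le> d2" "3 * h \<le> r" by (auto simp: h_def)
  have near: "dist (x + s *\<^sub>R axis i 1 + t *\<^sub>R axis j 1) x < 3 * h"
    if "0 \<le> s" "s \<le> h" "0 \<le> t" "t \<le> h" for s t and i j :: 2
  proof -
    have "norm (s *\<^sub>R axis i 1 + t *\<^sub>R axis j (1::real)) \<le> s + t"
      using that norm_triangle_ineq[of "s *\<^sub>R axis i (1::real)" "t *\<^sub>R axis j 1"] by simp
    also have "\<dots> < 3 * h" using that h by linarith
    finally show ?thesis by (simp add: dist_norm add.assoc)
  qed
  have inU: "x + s *\<^sub>R axis i 1 + t *\<^sub>R axis j 1 \<in> U"
    if "0 \<le> s" "s \<le> h" "0 \<le> t" "t \<le> h" for s t and i j :: 2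
    using near[OF that, of i j] h r by (auto simp: dist_commute intro!: subsetD[OF r(2)])
  obtain s t where st: "0 < s" "s < h" "0 < t" "t < h"
    "f (x + h *\<^sub>R axis a 1 + h *\<^sub>R axis b 1) - f (x + h *\<^sub>R axis a 1) - f (x + h *\<^sub>R axis b 1) + f x
      = h\<^sup>2 * \<partial> b (\<partial> a f) (x + s *\<^sub>R axis a 1 + t *\<^sub>R axis b 1)"
    by (rule second_difference_mean_value[OF f h(1), of x a b]) (blast intro: inU that)+
  obtain s' t' where st': "0 < s'" "s' < h" "0 < t'" "t' < h"
    "f (x + h *\<^sub>R axis b 1 + h *\<^sub>R axis a 1) - f (x + h *\<^sub>R axis b 1) - f (x + h *\<^sub>R axis a 1) + f x
      = h\<^sup>2 * \<partial> a (\<partial> b f) (x + s' *\<^sub>R axis b 1 + t' *\<^sub>R axis a 1)"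
    by (rule second_difference_mean_value[OF f h(1), of x b a]) (blast intro: inU that)+
  have "h\<^sup>2 * \<partial> a (\<partial> b f) (x + s' *\<^sub>R axis b 1 + t' *\<^sub>R axis a 1)
      = h\<^sup>2 * \<partial> b (\<partial> a f) (x + s *\<^sub>R axis a 1 + t *\<^sub>R axis b 1)"
    unfolding st(5)[symmetric] st'(5)[symmetric] by (simp add: algebra_simps)
  then have "\<partial> a (\<partial> b f) (x + s' *\<^sub>R axis b 1 + t' *\<^sub>R axis a 1)
      = \<partial> b (\<partial> a f) (x + s *\<^sub>R axis a 1 + t *\<^sub>R axis b 1)"
    using h by simp
  moreover have "dist (\<partial> a (\<partial> b f) (x + s' *\<^sub>R axis b 1 + t' *\<^sub>R axis a 1)) (\<partial> a (\<partial> b f) x) < \<epsilon>"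
    using near[of s' t' b a] st' h by (intro d) auto
  moreover have "dist (\<partial> b (\<partial> a f) (x + s *\<^sub>R axis a 1 + t *\<^sub>R axis b 1)) (\<partial> b (\<partial> a f) x) < \<epsilon>"
    using near[of s t a b] st h by (intro d) auto
  ultimately show False unfolding \<epsilon>_def dist_real_def by argo
qed

end

section \<open>Common roots and resultants\<close>

lemma resultant_eq_0_if_common_root:
  fixes p q :: "real poly"
  assumes "poly p t = 0" "poly q t = 0" "p \<noteq> 0"
  shows "resultant p q = 0"
proof -
  have "[:-t, 1:] dvd gcd p q"
    using assms by (simp add: poly_eq_0_iff_dvd)
  moreover have "gcd p q \<noteq> 0" using assms by simp
  ultimately have "degree [:-t, 1:] \<le> degree (gcd p q)" by (rule dvd_imp_degree_le)
  then show ?thesis by (simp add: resultant_0_gcd)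
qed

section \<open>Charts with a parallel volume form\<close>

locale parallel_volume_chart = unimodular_chart G E for G :: tensor3 and E :: tensor2 +
  fixes U :: "coord set"
  assumes open_U: "open U"
    and smooth_G: "smooth_on U (G k a b)"
    and G_sym: "x \<in> U \<Longrightarrow> G k a b x = G k b a x"
    and smooth_E: "smooth_on U (E a b)"
    and E_skew: "x \<in> U \<Longrightarrow> E a b x = - E b a x"
    and E_nonzero: "x \<in> U \<Longrightarrow> E 1 2 x \<noteq> 0"
    and E_parallel: "x \<in> U \<Longrightarrow> nabla_bilin G E a b d x = 0"
begin

lemmas smooth_diff_at = smooth_on_differentiable_at[OF open_U]

lemmas smooth_rules =
  smooth_on_const[OF open_U] smooth_on_add[OF open_U] smooth_on_diff[OF open_U]
  smooth_on_mult[OF open_U] smooth_on_power[OF open_U] smooth_on_divide[OF open_U]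
  smooth_on_minus[OF open_U] smooth_on_sum[OF open_U] smooth_on_partial

lemma partial_add_smooth:
  "smooth_on U f \<Longrightarrow> smooth_on U g \<Longrightarrow> x \<in> U \<Longrightarrow> \<partial> a (\<lambda>x. f x + g x) x = \<partial> a f x + \<partial> a g x"
  by (simp add: partial_add smooth_diff_at)

lemma partial_diff_smooth:
  "smooth_on U f \<Longrightarrow> smooth_on U g \<Longrightarrow> x \<in> U \<Longrightarrow> \<partial> a (\<lambda>x. f x - g x) x = \<partial> a f x - \<partial> a g x"
  by (simp add: partial_diff smooth_diff_at)

lemma partial_mult_smooth:
  "smooth_on U f \<Longrightarrow> smooth_on U g \<Longrightarrow> x \<in> U \<Longrightarrow>
    \<partial> a (\<lambda>x. f x * g x) x = \<partial> a f x * g x + f x * \<partial> a g x"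
  by (simp add: partial_mult smooth_diff_at)

lemma partial_minus_smooth: "smooth_on U f \<Longrightarrow> x \<in> U \<Longrightarrow> \<partial> a (\<lambda>x. - f x) x = - \<partial> a f x"
  using partial_diff_smooth[OF smooth_on_const[OF open_U, of 0]] by (simp add: partial_const)

lemmas partial_rules = partial_add_smooth partial_diff_smooth partial_minus_smooth
  partial_mult_smooth partial_const

lemma partial_commute_smooth:
  "smooth_on U f \<Longrightarrow> x \<in> U \<Longrightarrow> \<partial> 2 (\<partial> 1 f) x = \<partial> 1 (\<partial> 2 f) x"
  by (rule partial_commute[OF open_U]) (simp_all add: smooth_on_def)

lemma E_diag: "x \<in> U \<Longrightarrow> E 1 1 x = 0" "x \<in> U \<Longrightarrow> E 2 2 x = 0"
  and E_21: "x \<in> U \<Longrightarrow> E 2 1 x = - E 1 2 x"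
  using E_skew[of x 1 1] E_skew[of x 2 2] E_skew[of x 2 1] by auto

lemma partial_E_12: "x \<in> U \<Longrightarrow> \<partial> a (E 1 2) x = (G 1 a 1 x + G 2 a 2 x) * E 1 2 x"
  using E_parallel[of x a 1 2] by (simp add: nabla_bilin_def sum_2 E_diag algebra_simps)

lemma G_21: "x \<in> U \<Longrightarrow> G k 2 1 x = G k 1 2 x"
  by (rule G_sym)

lemma partial_G_21: "x \<in> U \<Longrightarrow> \<partial> a (G k 2 1) x = \<partial> a (G k 1 2) x"
  by (rule partial_cong[OF open_U]) (auto intro: G_21)

text \<open>
  The trace of the connection is the gradient of \<open>ln \<bar>\<epsilon>\<^sub>1\<^sub>2\<bar>\<close>, hence a closed form. This is what makes
  the Ricci tensor symmetric.
\<close>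

lemma partial_trace_G:
  assumes x: "x \<in> U"
  shows "\<partial> 1 (G 1 1 2) x + \<partial> 1 (G 2 2 2) x = \<partial> 2 (G 1 1 1) x + \<partial> 2 (G 2 1 2) x"
proof -
  have E2: "\<partial> c (\<partial> a (E 1 2)) x =
      (\<partial> c (G 1 a 1) x + \<partial> c (G 2 a 2) x) * E 1 2 x
      + (G 1 a 1 x + G 2 a 2 x) * ((G 1 c 1 x + G 2 c 2 x) * E 1 2 x)" for a c
  proof -
    have "\<partial> c (\<partial> a (E 1 2)) x = \<partial> c (\<lambda>y. (G 1 a 1 y + G 2 a 2 y) * E 1 2 y) x"
      by (rule partial_cong[OF open_U x partial_E_12])
    then show ?thesis
      by (simp add: partial_rules smooth_rules smooth_G smooth_E x partial_E_12)
  qed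
  have "(\<partial> 1 (G 1 1 2) x + \<partial> 1 (G 2 2 2) x) * E 1 2 x
      = (\<partial> 2 (G 1 1 1) x + \<partial> 2 (G 2 1 2) x) * E 1 2 x"
    using partial_commute_smooth[OF smooth_E[of 1 2] x] E2[of 1 2] E2[of 2 1]
    by (simp add: partial_G_21[OF x] G_21[OF x] algebra_simps)
  then show ?thesis using E_nonzero[OF x] by simp
qed

lemma ricci_sym: "x \<in> U \<Longrightarrow> ricci G 2 1 x = ricci G 1 2 x"
  using partial_trace_G[of x]
  by (simp add: ricci_def curv_def sum_2 partial_G_21 G_21 algebra_simps)

lemma P_ricci: "x \<in> U \<Longrightarrow> P a b x = ricci G a b x"
  using exhaust_2[of a] exhaust_2[of b] by (auto simp: rho_tensor_def ricci_sym algebra_simps)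

lemma P_21: "x \<in> U \<Longrightarrow> P 2 1 x = P 1 2 x"
  by (simp add: P_ricci ricci_sym)

lemma partial_P_21: "x \<in> U \<Longrightarrow> \<partial> a (P 2 1) x = \<partial> a (P 1 2) x"
  by (rule partial_cong[OF open_U]) (auto intro: P_21)

text \<open>
  In dimension two the Ricci tensor determines the curvature:
  \<open>R\<^sub>a\<^sub>b\<^sup>c\<^sub>d = \<delta>\<^sub>a\<^sup>c P\<^sub>b\<^sub>d - \<delta>\<^sub>b\<^sup>c P\<^sub>a\<^sub>d\<close>.
\<close>

lemma curv_12:
  assumes "x \<in> U"
  shows "curv G 1 2 1 b x = P 2 b x" "curv G 1 2 2 b x = - P 1 b x"
  using assms by (simp_all add: P_ricci ricci_def curv_def sum_2)

lemma smooth_P: "smooth_on U (P a b)"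
  unfolding rho_tensor_def[abs_def] ricci_def[abs_def] curv_def[abs_def]
  by (intro smooth_rules smooth_G) simp_all

lemma smooth_cov_vec: "(\<And>a. smooth_on U (X a)) \<Longrightarrow> smooth_on U (nabla_vec G X a k)"
  unfolding nabla_vec_def[abs_def] by (intro smooth_rules smooth_G) simp_all

lemma smooth_Y_low: "smooth_on U (Y_low a)"
  unfolding Y_low_def[abs_def] E_inv_def[abs_def] cotton_york_def[abs_def] nabla_bilin_def[abs_def]
  by (intro smooth_rules smooth_G smooth_P smooth_E) (auto simp: E_nonzero)

lemma smooth_Y: "smooth_on U (Y a)"
  unfolding Y_def raise_def[abs_def] E_inv_def[abs_def]
  by (intro smooth_rules smooth_Y_low smooth_E) (auto simp: E_nonzero)

lemma smooth_phi: "smooth_on U phi"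
  unfolding phi_def[abs_def] divergence_def[abs_def]
  by (intro smooth_rules smooth_cov_vec smooth_Y)

lemma smooth_W: "smooth_on U (W a)"
  unfolding W_def[abs_def]
  by (intro smooth_rules smooth_cov_vec smooth_Y smooth_phi) simp_all

lemma smooth_ell: "smooth_on U ell"
  unfolding ell_def[abs_def] P_contr_def[abs_def] deriv_along_def[abs_def]
  by (intro smooth_rules smooth_Y smooth_phi smooth_P) simp_all

lemma Y_low_cotton:
  assumes "x \<in> U"
  shows "E 1 2 x * Y_low b x = 2 * (nabla_bilin G P 1 2 b x - nabla_bilin G P 2 1 b x)"
  using E_nonzero[OF assms]
  by (simp add: Y_low_def E_inv_def sum_2 cotton_york_def E_diag E_21 assms power2_eq_square field_simps)

lemma Y_low_raise:
  assumes "x \<in> U"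
  shows "Y_low 1 x = - (E 1 2 x * Y 2 x)" "Y_low 2 x = E 1 2 x * Y 1 x"
  using E_nonzero[OF assms]
  by (simp_all add: Y_def raise_def E_inv_def sum_2 E_diag E_21 assms power2_eq_square)

lemma lower_Y: "x \<in> U \<Longrightarrow> lower Y b x = Y_low b x"
  using exhaust_2[of b] by (auto simp: lower_def sum_2 E_diag E_21 Y_low_raise)

text \<open>
  Raising an index commutes with \<open>\<nabla>\<close>, so the divergence of \<open>Y\<^sup>a\<close> is the curl of \<open>Y\<^sub>a\<close>, in which
  the Christoffel symbols cancel.
\<close>

lemma phi_curl:
  assumes x: "x \<in> U"
  shows "E 1 2 x * phi x = 2 * (\<partial> 1 (Y_low 2) x - \<partial> 2 (Y_low 1) x)"
proof -
  have "\<partial> 1 (Y_low 2) x = \<partial> 1 (\<lambda>x. E 1 2 x * Y 1 x) x"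
    by (rule partial_cong[OF open_U x]) (rule Y_low_raise)
  moreover have "\<partial> 2 (Y_low 1) x = \<partial> 2 (\<lambda>x. - (E 1 2 x * Y 2 x)) x"
    by (rule partial_cong[OF open_U x]) (simp add: Y_low_raise)
  ultimately show ?thesis
    by (simp add: partial_rules smooth_rules smooth_E smooth_Y x partial_E_12
        phi_def divergence_def nabla_vec_def sum_2 G_21 algebra_simps)
qed

text \<open>
  The contraction \<open>\<epsilon>\<^sub>a\<^sub>b X\<^sup>a Z\<^sup>b\<close>, in terms of the single independent component of \<open>\<epsilon>\<close>.
\<close>

definition eps :: "tensor1 \<Rightarrow> tensor1 \<Rightarrow> scalar" where
  "eps X Z x = E 1 2 x * (X 1 x * Z 2 x - X 2 x * Z 1 x)"

definition cov :: "tensor1 \<Rightarrow> tensor1 \<Rightarrow> tensor1" where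
  "cov X V b x = (\<Sum>a\<in>UNIV. X a x * nabla_vec G V a b x)"

lemma nabla_form_lower:
  assumes x: "x \<in> U" and V: "\<And>a. smooth_on U (V a)"
  shows "nabla_form G (lower V) a b x = (\<Sum>k\<in>UNIV. nabla_vec G V a k x * E k b x)"
proof -
  have "\<partial> a (lower V 1) x = \<partial> a (\<lambda>x. - (E 1 2 x * V 2 x)) x"
    "\<partial> a (lower V 2) x = \<partial> a (\<lambda>x. E 1 2 x * V 1 x) x" for a
    by (rule partial_cong[OF open_U x]; simp add: lower_def sum_2 E_diag E_21)+
  then have *: "\<partial> a (lower V 1) x = - ((G 1 a 1 x + G 2 a 2 x) * E 1 2 x * V 2 x + E 1 2 x * \<partial> a (V 2) x)"
    "\<partial> a (lower V 2) x = (G 1 a 1 x + G 2 a 2 x) * E 1 2 x * V 1 x + E 1 2 x * \<partial> a (V 1) x" for a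
    by (simp_all add: partial_rules smooth_rules smooth_E V x partial_E_12)
  show ?thesis
    using exhaust_2[of a] exhaust_2[of b]
    by (auto simp: nabla_form_def nabla_vec_def lower_def sum_2 * E_diag E_21 x algebra_simps)
qed

text \<open>
  As \<open>\<epsilon>\<close> is parallel, lowering an index commutes with \<open>\<nabla>\<close>. All contractions in the coefficients of
  the polynomials thereby become areas spanned by covariant derivatives of \<open>Y\<close> and \<open>W\<close>.
\<close>

lemma nabla_contr_lower:
  assumes "x \<in> U" "\<And>a. smooth_on U (V a)"
  shows "nabla_contr X Z (lower V) x = eps (cov X V) Z x"
  by (simp add: nabla_contr_def nabla_form_lower assms eps_def cov_def sum_2 E_diag E_21 algebra_simps)

lemma nabla_contr_Y_low:
  assumes x: "x \<in> U"
  shows "nabla_contr X Z Y_low x = eps (cov X Y) Z x"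
proof -
  have "\<partial> a (Y_low b) x = \<partial> a (lower Y b) x" for a b
    by (rule partial_cong[OF open_U x]) (simp add: lower_Y)
  then have "nabla_contr X Z Y_low x = nabla_contr X Z (lower Y) x"
    by (simp add: nabla_contr_def nabla_form_def lower_Y x)
  then show ?thesis by (simp add: nabla_contr_lower smooth_Y x)
qed

lemma nabla_contr_W_low: "x \<in> U \<Longrightarrow> nabla_contr X Z W_low x = eps (cov X W) Z x"
  by (simp add: W_low_def nabla_contr_lower smooth_W)

lemma deriv_along_eps:
  assumes x: "x \<in> U" and V: "\<And>a. smooth_on U (V a)" and Z: "\<And>a. smooth_on U (Z a)"
  shows "deriv_along X (eps V Z) x = eps (cov X V) Z x + eps V (cov X Z) x"
  by (simp add: deriv_along_def sum_2 eps_def[abs_def] partial_rules smooth_rules smooth_E V Z x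
      partial_E_12)
    (simp add: eps_def cov_def nabla_vec_def sum_2 algebra_simps)

text \<open>
  For an endomorphism \<open>T\<close> of a plane, \<open>\<epsilon>(T X, Z) + \<epsilon>(X, T Z) = tr(T) \<epsilon>(X, Z)\<close>; here
  \<open>T = \<nabla>V\<close>.
\<close>

lemma divergence_eps:
  "eps (cov X V) Z x - eps (cov Z V) X x = eps X Z x * divergence V x"
  by (simp add: eps_def cov_def divergence_def sum_2 algebra_simps)

lemma rho_eps: "x \<in> U \<Longrightarrow> rho x = eps Y W x"
  by (simp add: rho_def sum_2 eps_def Y_low_raise algebra_simps)

lemma cov_Y_Y: "cov Y Y a x = W a x + 2 * phi x / 3 * Y a x"
  by (simp add: cov_def W_def)

text \<open>
  The product rule for \<open>\<rho> = \<epsilon>(Y, W)\<close>. With the two lemmas that follow, it trades the contractions in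
  the equation for \<open>P\<^sub>1\<close> for derivatives of \<open>\<rho>\<close> and divergences.
\<close>

lemma deriv_along_rho:
  assumes x: "x \<in> U"
  shows "deriv_along X rho x = nabla_contr X W Y_low x - nabla_contr X Y W_low x"
proof -
  have "\<partial> a rho x = \<partial> a (eps Y W) x" for a
    by (rule partial_cong[OF open_U x rho_eps])
  then have "deriv_along X rho x = deriv_along X (eps Y W) x" by (simp add: deriv_along_def)
  then show ?thesis
    by (simp add: deriv_along_eps smooth_Y smooth_W x nabla_contr_Y_low nabla_contr_W_low)
      (simp add: eps_def algebra_simps)
qed

lemma nabla_W_Y_Y_low:
  assumes x: "x \<in> U"
  shows "nabla_contr W Y Y_low x = rho x * phi x / 6"
proof -
  have "eps (cov Y Y) W x = 2 * phi x / 3 * rho x"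
    by (simp add: eps_def cov_Y_Y rho_eps x algebra_simps)
  moreover have "eps W Y x = - rho x" by (simp add: eps_def rho_eps x algebra_simps)
  ultimately have "eps (cov W Y) Y x = 2 * phi x / 3 * rho x - rho x * (phi x / 2)"
    using divergence_eps[of W Y Y x] by (simp add: phi_def algebra_simps)
  then show ?thesis by (simp add: nabla_contr_Y_low x field_simps)
qed

lemma nabla_W_Y_W_low:
  assumes x: "x \<in> U"
  shows "nabla_contr W Y W_low x = nabla_contr Y W W_low x - rho x * divergence W x"
proof -
  have "eps W Y x = - rho x" by (simp add: eps_def rho_eps x algebra_simps)
  then show ?thesis
    using divergence_eps[of W W Y x] by (simp add: nabla_contr_W_low x)
qed

end

section \<open>Prolongation of the pEW equation\<close>

locale pEW_chart = parallel_volume_chart G E U for G E U +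
  fixes \<alpha> :: tensor1
  assumes smooth_\<alpha>: "smooth_on U (\<alpha> a)"
    and rho_nonzero: "x \<in> U \<Longrightarrow> rho x \<noteq> 0"
    and pEW: "x \<in> U \<Longrightarrow> (nabla_form G \<alpha> a b x + nabla_form G \<alpha> b a x) / 2
        + \<alpha> a x * \<alpha> b x + (P a b x + P b a x) / 2 = 0"
begin

text \<open>The function with \<open>\<nabla>\<^sub>[\<^sub>a \<alpha>\<^sub>b\<^sub>] = F \<epsilon>\<^sub>a\<^sub>b\<close>; the Christoffel symbols cancel in the skew part.\<close>

definition F :: scalar where
  "F x = (\<partial> 1 (\<alpha> 2) x - \<partial> 2 (\<alpha> 1) x) / (2 * E 1 2 x)"

definition pair :: "tensor1 \<Rightarrow> scalar" where
  "pair X x = (\<Sum>a\<in>UNIV. \<alpha> a x * X a x)"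

lemma smooth_F: "smooth_on U F"
  unfolding F_def[abs_def] by (intro smooth_rules smooth_\<alpha> smooth_E) (auto simp: E_nonzero)

lemma pEW_prolonged:
  assumes x: "x \<in> U"
  shows "\<partial> a (\<alpha> b) x = G 1 a b x * \<alpha> 1 x + G 2 a b x * \<alpha> 2 x
    - \<alpha> a x * \<alpha> b x - P a b x + F x * E a b x"
proof -
  have F: "2 * (F x * E 1 2 x) = \<partial> 1 (\<alpha> 2) x - \<partial> 2 (\<alpha> 1) x"
    using E_nonzero[OF x] by (simp add: F_def)
  show ?thesis
    using exhaust_2[of a] exhaust_2[of b] pEW[OF x, of a b] F
    by (auto simp: nabla_form_def sum_2 G_21 P_21 E_diag E_21 x field_simps)
qed

text \<open>
  Integrability of the equation for \<open>\<nabla>\<alpha>\<close>. The Ricci identity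
  \<open>(\<nabla>\<^sub>1 \<nabla>\<^sub>2 - \<nabla>\<^sub>2 \<nabla>\<^sub>1) \<alpha>\<^sub>b = - R\<^sub>1\<^sub>2\<^sup>d\<^sub>b \<alpha>\<^sub>d\<close> absorbs the terms linear in \<open>P\<close>, and the skew
  derivative of \<open>P\<close> that remains is the Cotton-York tensor.
\<close>

lemma partial_F:
  assumes x: "x \<in> U"
  shows "\<partial> b F x = - 3 * F x * \<alpha> b x - Y_low b x / 2"
proof -
  have D: "\<partial> c (\<partial> a (\<alpha> b)) x =
      \<partial> c (G 1 a b) x * \<alpha> 1 x + G 1 a b x * \<partial> c (\<alpha> 1) x
      + \<partial> c (G 2 a b) x * \<alpha> 2 x + G 2 a b x * \<partial> c (\<alpha> 2) x
      - \<partial> c (\<alpha> a) x * \<alpha> b x - \<alpha> a x * \<partial> c (\<alpha> b) x - \<partial> c (P a b) x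
      + \<partial> c F x * E a b x + F x * \<partial> c (E a b) x" for a b c
  proof -
    have "\<partial> c (\<partial> a (\<alpha> b)) x = \<partial> c (\<lambda>x. G 1 a b x * \<alpha> 1 x + G 2 a b x * \<alpha> 2 x
        - \<alpha> a x * \<alpha> b x - P a b x + F x * E a b x) x"
      by (rule partial_cong[OF open_U x pEW_prolonged])
    then show ?thesis
      by (simp add: partial_rules smooth_rules smooth_\<alpha> smooth_G smooth_P smooth_F smooth_E x)
  qed
  have dE: "\<partial> a (E 1 1) x = 0" "\<partial> a (E 2 2) x = 0"
    "\<partial> a (E 2 1) x = - ((G 1 a 1 x + G 2 a 2 x) * E 1 2 x)" for a
  proof -
    have "\<partial> a (E 1 1) x = \<partial> a (\<lambda>x. 0) x" "\<partial> a (E 2 2) x = \<partial> a (\<lambda>x. 0) x"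
      "\<partial> a (E 2 1) x = \<partial> a (\<lambda>x. - E 1 2 x) x"
      by (rule partial_cong[OF open_U x]; simp add: E_diag E_21)+
    then show "\<partial> a (E 1 1) x = 0" "\<partial> a (E 2 2) x = 0"
      "\<partial> a (E 2 1) x = - ((G 1 a 1 x + G 2 a 2 x) * E 1 2 x)"
      by (simp_all add: partial_const partial_minus_smooth smooth_E x partial_E_12)
  qed
  have curv: "\<partial> 1 (G k 2 b) x = \<partial> 2 (G k 1 b) x
      - (G k 1 1 x * G 1 2 b x + G k 1 2 x * G 2 2 b x)
      + (G k 1 2 x * G 1 1 b x + G k 2 2 x * G 2 1 b x) + curv G 1 2 k b x" for k b
    by (simp add: curv_def sum_2 G_21 x)
  note R = curv_12[OF x] P_21[OF x] partial_P_21[OF x] dE partial_E_12[OF x] E_diag[OF x] E_21[OF x]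
    G_21[OF x]
  have "E 1 2 x * \<partial> b F x = E 1 2 x * (- 3 * F x * \<alpha> b x - Y_low b x / 2)"
    if b: "b = 1 \<or> b = 2"
    using b
  proof
    assume b: "b = 1"
    have "\<partial> 2 (\<partial> 1 (\<alpha> 1)) x = \<partial> 1 (\<partial> 2 (\<alpha> 1)) x"
      by (rule partial_commute_smooth[OF smooth_\<alpha> x])
    then show ?thesis
      using Y_low_cotton[OF x, of 1] unfolding b D curv pEW_prolonged[OF x]
      \<comment> \<open>Symbols with lower indices \<open>2 1\<close> are rewritten to \<open>1 2\<close>, so \<open>curv\<close> is needed in this form.\<close>
      by (simp add: R nabla_bilin_def sum_2 algebra_simps partial_G_21[OF x]
          curv[of _ 1, unfolded partial_G_21[OF x]])
  next
    assume b: "b = 2"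
    have "\<partial> 2 (\<partial> 1 (\<alpha> 2)) x = \<partial> 1 (\<partial> 2 (\<alpha> 2)) x"
      by (rule partial_commute_smooth[OF smooth_\<alpha> x])
    then show ?thesis
      using Y_low_cotton[OF x, of 2] unfolding b D curv pEW_prolonged[OF x]
      by (simp add: R nabla_bilin_def sum_2 algebra_simps)
  qed
  then show ?thesis using E_nonzero[OF x] exhaust_2[of b] by simp
qed

text \<open>
  Integrability of the equation for \<open>\<nabla>F\<close>: the exterior derivative of \<open>3 F \<alpha> + Y / 2\<close> vanishes. The
  prolonged system is already closed, so this condition contains no derivatives of \<open>\<alpha>\<close> or \<open>F\<close>.
\<close>

lemma pair_Y:
  assumes x: "x \<in> U"
  shows "pair Y x = - 4 * (F x)\<^sup>2 - phi x / 6"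
proof -
  have D: "\<partial> c (\<partial> b F) x = - 3 * (\<partial> c F x * \<alpha> b x + F x * \<partial> c (\<alpha> b) x) - \<partial> c (Y_low b) x * (1/2)"
    for b c
  proof -
    have "\<partial> c (\<partial> b F) x = \<partial> c (\<lambda>x. - 3 * (F x * \<alpha> b x) - Y_low b x * (1/2)) x"
      by (rule partial_cong[OF open_U x]) (simp add: partial_F)
    also have "\<dots> = - 3 * (\<partial> c F x * \<alpha> b x + F x * \<partial> c (\<alpha> b) x) - \<partial> c (Y_low b) x * (1/2)"
      by (subst partial_rules; (intro smooth_rules smooth_F smooth_\<alpha> smooth_Y_low x)?)+
        (simp add: partial_rules smooth_F smooth_\<alpha> x)
    finally show ?thesis .
  qed
  have skew: "\<partial> 1 (\<alpha> 2) x - \<partial> 2 (\<alpha> 1) x = 2 * (F x * E 1 2 x)"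
    using E_nonzero[OF x] by (simp add: F_def)
  have "\<partial> 2 (\<partial> 1 F) x = \<partial> 1 (\<partial> 2 F) x"
    by (rule partial_commute_smooth[OF smooth_F x])
  then have "3 * (Y_low 2 x * \<alpha> 1 x - Y_low 1 x * \<alpha> 2 x)
      = - 6 * F x * (\<partial> 1 (\<alpha> 2) x - \<partial> 2 (\<alpha> 1) x) - (\<partial> 1 (Y_low 2) x - \<partial> 2 (Y_low 1) x)"
    unfolding D by (simp add: partial_F x algebra_simps)
  also have "\<dots> = E 1 2 x * (- 12 * (F x)\<^sup>2 - phi x / 2)"
    unfolding skew using phi_curl[OF x] by (simp add: algebra_simps power2_eq_square)
  also have "Y_low 2 x * \<alpha> 1 x - Y_low 1 x * \<alpha> 2 x = E 1 2 x * pair Y x"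
    by (simp add: pair_def sum_2 Y_low_raise x algebra_simps)
  finally have "E 1 2 x * (3 * pair Y x) = E 1 2 x * (- 12 * (F x)\<^sup>2 - phi x / 2)"
    by (simp add: algebra_simps)
  then show ?thesis using E_nonzero[OF x] by simp
qed

lemma deriv_along_F:
  "x \<in> U \<Longrightarrow> deriv_along X F x = - 3 * F x * pair X x - eps Y X x / 2"
  by (simp add: deriv_along_def partial_F pair_def sum_2 Y_low_raise eps_def field_simps)

text \<open>
  The Leibniz rule \<open>X(\<alpha>(V)) = (\<nabla>\<^sub>X \<alpha>)(V) + \<alpha>(\<nabla>\<^sub>X V)\<close>, with the prolonged equation inserted for
  \<open>\<nabla>\<alpha>\<close>.
\<close>

lemma deriv_along_pair:
  assumes x: "x \<in> U" and V: "\<And>a. smooth_on U (V a)"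
  shows "deriv_along X (pair V) x = - pair X x * pair V x - P_contr X V x + F x * eps X V x
    + pair (cov X V) x"
proof -
  have D: "\<partial> a (pair V) x = \<partial> a (\<alpha> 1) x * V 1 x + \<alpha> 1 x * \<partial> a (V 1) x
      + (\<partial> a (\<alpha> 2) x * V 2 x + \<alpha> 2 x * \<partial> a (V 2) x)" for a
    unfolding pair_def[abs_def] sum_2 by (simp add: partial_rules smooth_rules smooth_\<alpha> V x)
  show ?thesis
    unfolding deriv_along_def sum_2 D
    by (simp add: pEW_prolonged x pair_def P_contr_def eps_def cov_def nabla_vec_def
        sum_2 E_diag E_21 P_21 G_21 algebra_simps)
qed

text \<open>
  This eliminates \<open>\<alpha>\<close>: by Cramer's rule in the frame \<open>Y, W\<close>,
  \<open>\<rho> \<alpha>(V) = \<epsilon>(V, W) \<alpha>(Y) - \<epsilon>(V, Y) \<alpha>(W)\<close> for every vector \<open>V\<close>.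
\<close>

lemma pair_cov:
  assumes x: "x \<in> U"
  shows "pair (cov X Y) x
      = (pair Y x * nabla_contr X W Y_low x - pair W x * nabla_contr X Y Y_low x) / rho x"
    and "pair (cov X W) x
      = (pair Y x * nabla_contr X W W_low x - pair W x * nabla_contr X Y W_low x) / rho x"
proof -
  have cramer: "pair V x = (pair Y x * eps V W x - pair W x * eps V Y x) / rho x" for V
    using rho_nonzero[OF x]
    by (simp add: nonzero_eq_divide_eq) (simp add: rho_eps x eps_def pair_def sum_2 algebra_simps)
  show "pair (cov X Y) x
      = (pair Y x * nabla_contr X W Y_low x - pair W x * nabla_contr X Y Y_low x) / rho x"
    using cramer[of "cov X Y"] by (simp add: nabla_contr_Y_low x)
  show "pair (cov X W) x
      = (pair Y x * nabla_contr X W W_low x - pair W x * nabla_contr X Y W_low x) / rho x"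
    using cramer[of "cov X W"] by (simp add: nabla_contr_W_low x)
qed

lemma deriv_along_pair_Y:
  assumes x: "x \<in> U"
  shows "deriv_along X (pair Y) x = - 8 * F x * deriv_along X F x - deriv_along X phi x / 6"
proof -
  have D: "\<partial> a (pair Y) x = - 8 * F x * \<partial> a F x - \<partial> a phi x / 6" for a
  proof -
    have "\<partial> a (pair Y) x = \<partial> a (\<lambda>x. - 4 * (F x * F x) - phi x * (1/6)) x"
      by (rule partial_cong[OF open_U x]) (simp add: pair_Y power2_eq_square)
    also have "\<dots> = - 8 * F x * \<partial> a F x - \<partial> a phi x / 6"
      by (subst partial_diff_smooth partial_mult_smooth; (intro smooth_rules smooth_F smooth_phi x)?)+
        (simp add: partial_const)
    finally show ?thesis .
  qed
  show ?thesis by (simp add: deriv_along_def sum_2 D algebra_simps add_divide_distrib)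
qed

text \<open>
  Two expressions for \<open>Y(\<alpha>(Y))\<close>, one by the Leibniz rule and one from the formula for \<open>\<alpha>(Y)\<close>. The
  former contains \<open>\<alpha>(\<nabla>\<^sub>Y Y)\<close>, and \<open>\<nabla>\<^sub>Y Y\<close> is \<open>W\<close> up to a multiple of \<open>Y\<close>. The term with
  \<open>F\<close> drops out since \<open>\<epsilon>(Y, Y) = 0\<close>.
\<close>

lemma pair_W:
  assumes x: "x \<in> U"
  shows "pair W x = - 80 * F x ^ 4 + ell x / 3"
proof -
  have cov: "pair (cov Y Y) x = pair W x + 2 * phi x / 3 * pair Y x"
    by (simp add: pair_def sum_2 cov_Y_Y algebra_simps)
  have eps: "eps Y Y x = 0" by (simp add: eps_def)
  show ?thesis
    using deriv_along_pair[where X = Y and V = Y, OF x smooth_Y] deriv_along_pair_Y[OF x, of Y]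
    unfolding deriv_along_F[OF x] cov eps pair_Y[OF x]
    by (simp add: ell_def field_simps power2_eq_square power4_eq_xxxx)
qed

lemma deriv_along_pair_W:
  assumes x: "x \<in> U"
  shows "deriv_along X (pair W) x = - 320 * F x ^ 3 * deriv_along X F x + deriv_along X ell x / 3"
proof -
  have D: "\<partial> a (pair W) x = - 320 * F x ^ 3 * \<partial> a F x + \<partial> a ell x / 3" for a
  proof -
    have "\<partial> a (pair W) x = \<partial> a (\<lambda>x. - 80 * ((F x * F x) * (F x * F x)) + ell x * (1/3)) x"
      by (rule partial_cong[OF open_U x]) (simp add: pair_W power4_eq_xxxx)
    also have "\<dots> = - 320 * F x ^ 3 * \<partial> a F x + \<partial> a ell x / 3"
      by (subst partial_add_smooth partial_mult_smooth; (intro smooth_rules smooth_F smooth_ell x)?)+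
        (simp add: partial_const algebra_simps power3_eq_cube)
    finally show ?thesis .
  qed
  show ?thesis by (simp add: deriv_along_def sum_2 D algebra_simps add_divide_distrib)
qed

section \<open>The common root\<close>

text \<open>
  The remaining derivatives of the two constraints, computed in two ways as for \<open>pair_W\<close>: \<open>W\<close> of
  \<open>\<alpha>(Y)\<close>, \<open>Y\<close> of \<open>\<alpha>(W)\<close> and \<open>W\<close> of \<open>\<alpha>(W)\<close>. Here \<open>A\<close> and \<open>B\<close> are the values of
  \<open>\<alpha>(Y)\<close> and \<open>\<alpha>(W)\<close>, so \<open>F\<close> is the only unknown that depends on \<open>\<alpha>\<close>.
\<close>

lemma pair_derivatives:
  assumes x: "x \<in> U"
  defines "A \<equiv> - 4 * (F x)\<^sup>2 - phi x / 6" and "B \<equiv> - 80 * F x ^ 4 + ell x / 3"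
  shows "- A * B - P_contr W Y x
      + (A * (nabla_contr W W Y_low x / rho x) - B * (nabla_contr W Y Y_low x / rho x))
      - 24 * (F x)\<^sup>2 * B - 5 * rho x * F x + deriv_along W phi x / 6 = 0"
    and "- A * B - P_contr W Y x
      + (A * (nabla_contr Y W W_low x / rho x) - B * (nabla_contr Y Y W_low x / rho x))
      - 960 * F x ^ 4 * A + rho x * F x - deriv_along Y ell x / 3 = 0"
    and "- B\<^sup>2 - P_contr W W x
      + (A * (nabla_contr W W W_low x / rho x) - B * (nabla_contr W Y W_low x / rho x))
      - 960 * F x ^ 4 * B - 160 * rho x * F x ^ 3 - deriv_along W ell x / 3 = 0"
proof -
  have eps: "eps W Y x = - rho x" "eps Y W x = rho x" "eps W W x = 0" "eps Y Y x = 0"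
    by (simp_all add: rho_eps x) (simp_all add: eps_def algebra_simps)
  have sym: "P_contr Y W x = P_contr W Y x"
    by (simp add: P_contr_def sum_2 P_21 x algebra_simps)
  have A: "pair Y x = A" and B: "pair W x = B"
    by (simp_all add: A_def B_def pair_Y pair_W x)
  note R = deriv_along_F[OF x] pair_cov[OF x] A B eps sym diff_divide_distrib
  show "- A * B - P_contr W Y x
      + (A * (nabla_contr W W Y_low x / rho x) - B * (nabla_contr W Y Y_low x / rho x))
      - 24 * (F x)\<^sup>2 * B - 5 * rho x * F x + deriv_along W phi x / 6 = 0"
    using deriv_along_pair[where X = W and V = Y, OF x smooth_Y] deriv_along_pair_Y[OF x, of W]
    unfolding R by (simp add: algebra_simps power2_eq_square)
  show "- A * B - P_contr W Y x
      + (A * (nabla_contr Y W W_low x / rho x) - B * (nabla_contr Y Y W_low x / rho x))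
      - 960 * F x ^ 4 * A + rho x * F x - deriv_along Y ell x / 3 = 0"
    using deriv_along_pair[where X = Y and V = W, OF x smooth_W] deriv_along_pair_W[OF x, of Y]
    unfolding R by (simp add: algebra_simps power4_eq_xxxx power3_eq_cube)
  show "- B\<^sup>2 - P_contr W W x
      + (A * (nabla_contr W W W_low x / rho x) - B * (nabla_contr W Y W_low x / rho x))
      - 960 * F x ^ 4 * B - 160 * rho x * F x ^ 3 - deriv_along W ell x / 3 = 0"
    using deriv_along_pair[where X = W and V = W, OF x smooth_W] deriv_along_pair_W[OF x, of W]
    unfolding R by (simp add: algebra_simps power4_eq_xxxx power3_eq_cube power2_eq_square)
qed

lemma zero_if_multiple: "a = 0 \<Longrightarrow> b = - a \<Longrightarrow> b = (0::real)"
  by simp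

lemma zero_if_combination: "a = 0 \<Longrightarrow> a' = 0 \<Longrightarrow> b = c * a + d * a' \<Longrightarrow> b = (0::real)"
  by simp

lemma ratio_rho: "x \<in> U \<Longrightarrow> c = rho x * (c / rho x)"
  using rho_nonzero by simp

text \<open>
  In each of the next three proofs the quotients by \<open>\<rho>\<close> are named, since what remains is then an
  identity of polynomials with rational coefficients.
\<close>

lemma P2_root:
  assumes x: "x \<in> U"
  shows "poly (P2 x) (2 * F x) = 0"
proof -
  define n where "n = nabla_contr W W W_low x / rho x"
  define m where "m = nabla_contr W Y W_low x / rho x"
  have nm: "nabla_contr W W W_low x = rho x * n" "nabla_contr W Y W_low x = rho x * m"
    unfolding n_def m_def by (rule ratio_rho[OF x])+
  have coeffs: "b1 x = - (5 * m) + 50 * ell x / 3" "b2 x = n"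
    "b3 x = phi x * n / 6 + P_contr W W x + (ell x)\<^sup>2 / 9 + ell x * m / 3 + deriv_along W ell x / 3"
    using rho_nonzero[OF x] by (simp_all add: b1_def b2_def b3_def nm)
  show ?thesis
    by (rule zero_if_multiple[OF pair_derivatives(3)[OF x, folded n_def m_def]])
      (simp add: P2_def coeffs poly_monom power_numeral_reduce algebra_simps
          add_divide_distrib diff_divide_distrib)
qed

text \<open>The root of \<open>P\<^sub>3\<close> comes from the symmetric part of the two mixed equations.\<close>

lemma P3_root:
  assumes x: "x \<in> U"
  shows "poly (P3 x) (2 * F x) = 0"
proof -
  define n where "n = nabla_contr W W Y_low x / rho x"
  define m where "m = nabla_contr W Y Y_low x / rho x"
  define k where "k = nabla_contr Y W W_low x / rho x"
  define l where "l = nabla_contr Y Y W_low x / rho x"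
  have nm: "nabla_contr W W Y_low x = rho x * n" "nabla_contr W Y Y_low x = rho x * m"
    "nabla_contr Y W W_low x = rho x * k" "nabla_contr Y Y W_low x = rho x * l"
    unfolding n_def m_def k_def l_def by (rule ratio_rho[OF x])+
  have coeffs: "c1 x = - (5 * (m + l) / 2) - 25 * phi x / 6" "c2 x = 2 * ell x / 3 + (n + k) / 2"
    "c3 x = - (deriv_along W phi x / 12) + phi x * n / 12 + ell x * m / 6 + P_contr W Y x
     + deriv_along Y ell x / 6 + phi x * k / 12 - ell x * phi x / 18 + ell x * l / 6"
    using rho_nonzero[OF x] by (simp_all add: c1_def c2_def c3_def nm field_simps)
  show ?thesis
    by (rule zero_if_combination[OF pair_derivatives(1,2)[OF x, folded n_def m_def k_def l_def],
        where c = "-1/2" and d = "-1/2"])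
      (simp add: P3_def coeffs poly_monom power_numeral_reduce algebra_simps
          add_divide_distrib diff_divide_distrib)
qed

text \<open>
  The skew part of the same two equations. Its contractions occur only in the differences that the
  formulas for the derivatives of \<open>\<rho>\<close> and for the divergences of \<open>Y\<close> and \<open>W\<close> rewrite.
\<close>

lemma P1_root:
  assumes x: "x \<in> U"
  shows "poly (P1 x) (2 * F x) = 0"
proof -
  define n where "n = nabla_contr W W Y_low x / rho x"
  define k where "k = nabla_contr Y W W_low x / rho x"
  define l where "l = nabla_contr Y Y W_low x / rho x"
  have m: "nabla_contr W Y Y_low x / rho x = phi x / 6"
    using rho_nonzero[OF x] by (simp add: nabla_W_Y_Y_low x)
  have YWY: "nabla_contr Y W Y_low x = rho x * (2 * phi x / 3)"
    by (simp add: nabla_contr_Y_low x) (simp add: eps_def cov_Y_Y rho_eps x algebra_simps)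
  have Y: "deriv_along Y rho x / rho x = 2 * phi x / 3 - l"
    using rho_nonzero[OF x] by (simp add: deriv_along_rho x YWY l_def diff_divide_distrib)
  have W: "deriv_along W rho x / rho x = n - k + divergence W x"
    using rho_nonzero[OF x]
    by (simp add: deriv_along_rho nabla_W_Y_W_low x n_def k_def diff_divide_distrib)
  have W': "c * deriv_along W rho x / (d * rho x) = c / d * (deriv_along W rho x / rho x)" 
     "c * deriv_along W rho x / rho x = c * (deriv_along W rho x / rho x)" for c d
    by simp_all
  have coeffs: "a1 x = 15 * (2 * phi x / 3 - l - 5 * phi x / 2)"
    "a2 x = - (3 * (n - k + divergence W x) + 6 * ell x - 3 * divergence W x)"
    "a3 x = deriv_along W phi x / 2 + phi x / 2 * divergence W x + deriv_along Y ell x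
     + phi x * ell x / 2 - phi x / 2 * (n - k + divergence W x) - ell x * (2 * phi x / 3 - l)"
    unfolding a1_def a2_def a3_def W' W Y by simp_all
  show ?thesis
    by (rule zero_if_combination[OF pair_derivatives(1,2)[OF x, folded n_def k_def l_def, unfolded m],
        where c = 3 and d = "-3"])
      (simp add: P1_def coeffs poly_monom power_numeral_reduce algebra_simps
          add_divide_distrib diff_divide_distrib)
qed

lemma leading_coeffs: "coeff (P1 x) 6 = -90" "coeff (P2 x) 8 = -275"
  by (simp_all add: P1_def P2_def)

lemma resultants_vanish:
  assumes x: "x \<in> U"
  shows "resultant (P1 x) (P2 x) = 0 \<and> resultant (P2 x) (P3 x) = 0 \<and> resultant (P1 x) (P3 x) = 0"
proof -
  have "P1 x \<noteq> 0" "P2 x \<noteq> 0"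
    using leading_coeffs[of x] by auto
  with P1_root[OF x] P2_root[OF x] P3_root[OF x] show ?thesis
    using resultant_eq_0_if_common_root by blast
qed

end

section \<open>The theorem on a projective surface\<close>

theorem corollary3p2:
  fixes M :: "'m topology" and A :: "'m chart set"
    and S :: "('m chart \<Rightarrow> tensor3) set"
    and D :: "'m chart \<Rightarrow> tensor3"
    and \<epsilon> :: "'m chart \<Rightarrow> tensor2"
    and \<alpha> :: "'m chart \<Rightarrow> tensor1"
  assumes "smooth_surface M A"
    and "projective_structure A S"
    and "volume_form A \<epsilon>"
    and "D \<in> S" and "parallel_volume A D \<epsilon>"
    and "\<forall>c\<in>A. \<forall>p\<in>chart_dom c. unimodular_chart.rho (D c) (\<epsilon> c) (chart_map c p) \<noteq> 0"
    and "pEW_solution A D \<alpha>"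
  shows "\<forall>p\<in>topspace M. \<forall>c\<in>A. p \<in> chart_dom c \<longrightarrow>
    (let x = chart_map c p;
         P1 = unimodular_chart.P1 (D c) (\<epsilon> c) x;
         P2 = unimodular_chart.P2 (D c) (\<epsilon> c) x;
         P3 = unimodular_chart.P3 (D c) (\<epsilon> c) x
     in resultant P1 P2 = 0 \<and> resultant P2 P3 = 0 \<and> resultant P1 P3 = 0)"
proof (intro ballI impI)
  fix p c
  assume c: "c \<in> A" and p: "p \<in> chart_dom c"
  have D: "torsion_free_connection A D"
    using assms(2,4) unfolding projective_structure_def projective_equivalence_def
    by (auto elim!: quotientE)
  have on_dom: "\<exists>q\<in>chart_dom c. x = chart_map c q" if "x \<in> chart_range c" for x
    using that by (auto simp: chart_range_def)
  interpret pEW_chart "D c" "\<epsilon> c" "chart_range c" "\<alpha> c"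
  proof
    show "open (chart_range c)"
      using assms(1) c unfolding smooth_surface_def by blast
    show "smooth_on (chart_range c) (D c k a b)" for k a b
      using D c unfolding torsion_free_connection_def by blast
    show "D c k a b x = D c k b a x" if "x \<in> chart_range c" for x k a b
      using D c that unfolding torsion_free_connection_def by blast
    show "smooth_on (chart_range c) (\<epsilon> c a b)" for a b
      using assms(3) c unfolding volume_form_def by blast
    show "\<epsilon> c a b x = - \<epsilon> c b a x" "\<epsilon> c 1 2 x \<noteq> 0" if "x \<in> chart_range c" for x a b
      using assms(3) c that unfolding volume_form_def by blast+
    show "nabla_bilin (D c) (\<epsilon> c) a b d x = 0" if "x \<in> chart_range c" for x a b d
      using assms(5) c that unfolding parallel_volume_def by blast
    show "smooth_on (chart_range c) (\<alpha> c a)" for a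
      using assms(7) c unfolding pEW_solution_def one_form_def by blast
    show "unimodular_chart.rho (D c) (\<epsilon> c) x \<noteq> 0" if "x \<in> chart_range c" for x
      using assms(6) c on_dom[OF that] by blast
    show "(nabla_form (D c) (\<alpha> c) a b x + nabla_form (D c) (\<alpha> c) b a x) / 2
        + \<alpha> c a x * \<alpha> c b x + (rho_tensor (D c) a b x + rho_tensor (D c) b a x) / 2 = 0"
      if "x \<in> chart_range c" for x a b
      using assms(7) c that unfolding pEW_solution_def by blast
  qed
  show "let x = chart_map c p;
         P1 = unimodular_chart.P1 (D c) (\<epsilon> c) x;
         P2 = unimodular_chart.P2 (D c) (\<epsilon> c) x;
         P3 = unimodular_chart.P3 (D c) (\<epsilon> c) x
     in resultant P1 P2 = 0 \<and> resultant P2 P3 = 0 \<and> resultant P1 P3 = 0"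
    unfolding Let_def by (rule resultants_vanish) (simp add: chart_range_def p)
qed

end
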